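(* For every positive integer $n$, every connected graph $G$ with independence number at least $N_1(n+1)$ contains $P_n$, $H_n^1$, or $K_{1,n}$ as an induced subgraph.
   Context: All graphs are undirected, finite, and simple. $P_n$ is the path on $n$ vertices, $K_n$ is the complete graph on $n$ vertices, and $K_{n,m}$ is the complete bipartite graph with parts of sizes $n$ and $m$. "Contains $H$ as an induced subgraph" means that some induced subgraph is isomorphic to $H$. The independence number of $G$ is the maximum size of a set of pairwise non-adjacent vertices of $G$. For each positive integer $n$, $N_1(n)$ denotes an integer with the property that every connected graph on at least $N_1(n)$ vertices contains $P_n$, $K_n$, or $K_{1,n}$ as an induced subgraph. (Such an integer exists for every $n$, by a known theorem: Proposition 9.4.1 in Diestel's Graph Theory.) $H_n^{1}$ is the graph obtained from the complete graph on $n$ vertices $v_1,\ldots,v_n$ by identifying, for each $i$, the vertex $v_i$ with an end vertex of a new path with one edge (i.e. $K_n$ with exactly one pendant vertex attached to each of its vertices). *)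

theory Defs
  imports Complex_Main "HOL-Library.Ramsey"
begin

type_synonym 'a graph = "'a set \<times> 'a set set"

abbreviation verts :: "'a graph \<Rightarrow> 'a set" where
  "verts G \<equiv> fst G"

abbreviation edges :: "'a graph \<Rightarrow> 'a set set" where
  "edges G \<equiv> snd G"

text \<open>Edges are two-element sets of vertices, so graphs are undirected, without loops
  and without multiple edges.\<close>

definition simple_graph :: "'a graph \<Rightarrow> bool" where
  "simple_graph G \<longleftrightarrow> finite (verts G) \<and> edges G \<subseteq> [verts G]\<^bsup>2\<^esup>"

text \<open>The graph without vertices does not count as connected.\<close>

definition connected_graph :: "'a graph \<Rightarrow> bool" where
  "connected_graph G \<longleftrightarrow> verts G \<noteq> {} \<and>
     (\<forall>u \<in> verts G. \<forall>v \<in> verts G. (u, v) \<in> {(x, y). {x, y} \<in> edges G}\<^sup>*)"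

definition induced_subgraph :: "'a graph \<Rightarrow> 'a set \<Rightarrow> 'a graph" where
  "induced_subgraph G W = (W, {e \<in> edges G. e \<subseteq> W})"

definition graph_iso :: "'a graph \<Rightarrow> 'b graph \<Rightarrow> bool" where
  "graph_iso G H \<longleftrightarrow> (\<exists>f. bij_betw f (verts G) (verts H) \<and>
     (\<forall>u \<in> verts G. \<forall>v \<in> verts G. {u, v} \<in> edges G \<longleftrightarrow> {f u, f v} \<in> edges H))"

definition contains_induced :: "'a graph \<Rightarrow> 'b graph \<Rightarrow> bool" where
  "contains_induced G H \<longleftrightarrow> (\<exists>W \<subseteq> verts G. graph_iso (induced_subgraph G W) H)"

definition independence_number :: "'a graph \<Rightarrow> nat" where
  "independence_number G = Max {card S | S. S \<subseteq> verts G \<and> indep S (edges G)}"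

definition path_graph :: "nat \<Rightarrow> nat graph" where
  "path_graph n = ({..<n}, {{i, Suc i} | i. Suc i < n})"

definition complete_graph :: "nat \<Rightarrow> nat graph" where
  "complete_graph n = ({..<n}, [{..<n}]\<^bsup>2\<^esup>)"

definition complete_bipartite :: "nat \<Rightarrow> nat \<Rightarrow> (nat + nat) graph" where
  "complete_bipartite n m =
     (Inl ` {..<n} \<union> Inr ` {..<m}, {{Inl i, Inr j} | i j. i < n \<and> j < m})"

text \<open>In \<open>H1_graph n\<close>, \<open>Inl i\<close> is the vertex of the complete graph with index \<open>i\<close>
  and \<open>Inr i\<close> is the pendant vertex attached to it.\<close>

definition H1_graph :: "nat \<Rightarrow> (nat + nat) graph" where
  "H1_graph n =
     (Inl ` {..<n} \<union> Inr ` {..<n},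
      {{Inl i, Inl j} | i j. i < n \<and> j < n \<and> i \<noteq> j} \<union> {{Inl i, Inr i} | i. i < n})"

text \<open>\<open>N1_property n N\<close> says that \<open>N\<close> may serve as the integer \<open>N\<^sub>1(n)\<close>.
  Every finite graph is isomorphic to one whose vertices are natural numbers, so
  quantifying over graphs with vertices in \<^typ>\<open>nat\<close> covers all graphs.\<close>

definition N1_property :: "nat \<Rightarrow> int \<Rightarrow> bool" where
  "N1_property n N \<longleftrightarrow>
     (\<forall>G :: nat graph. simple_graph G \<and> connected_graph G \<and> N \<le> int (card (verts G)) \<longrightarrow>
        contains_induced G (path_graph n) \<or>
        contains_induced G (complete_graph n) \<or>
        contains_induced G (complete_bipartite 1 n))"

end

theory Submission
  imports Defs
begin

text \<open>Let \<open>S\<close> be a maximum independent set and \<open>W\<close> a minimal vertex set containing \<open>S\<close>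
  that induces a connected subgraph. As \<open>W\<close> has at least \<open>N\<^sub>1(n + 1)\<close> vertices, the only
  interesting case is that it contains a clique \<open>K\<close> of size \<open>n + 1\<close>. At most one vertex of
  \<open>K\<close> is in \<open>S\<close>, and by minimality each of the others is a cut vertex of \<open>W\<close>. So each of
  these \<open>n\<close> vertices \<open>v\<close> has a neighbour in a component of \<open>W - v\<close> that avoids \<open>K\<close>, and
  these neighbours are the pendant vertices of an induced \<open>H\<^sub>n\<^sup>1\<close>.\<close>

section \<open>Induced containment as embedding\<close>

text \<open>Inverting the isomorphism gives a map out of the pattern graph \<open>H\<close>. In this
  form witnesses can be written down explicitly, and containments compose like functions.\<close>

lemma contains_induced_iff_embedding:
  "contains_induced G H \<longleftrightarrow> (\<exists>g. inj_on g (verts H) \<and> g ` verts H \<subseteq> verts G \<and>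
     (\<forall>u \<in> verts H. \<forall>v \<in> verts H. {u, v} \<in> edges H \<longleftrightarrow> {g u, g v} \<in> edges G))"
  (is "_ \<longleftrightarrow> ?R")
proof
  assume "contains_induced G H"
  then obtain W f where W: "W \<subseteq> verts G" and f: "bij_betw f W (verts H)"
    and adj: "\<And>u v. u \<in> W \<Longrightarrow> v \<in> W \<Longrightarrow> {u, v} \<in> edges G \<longleftrightarrow> {f u, f v} \<in> edges H"
    by (auto simp: contains_induced_def graph_iso_def induced_subgraph_def)
  let ?g = "inv_into W f"
  have g: "bij_betw ?g (verts H) W"
    using f by (rule bij_betw_inv_into)
  have g_in: "?g u \<in> W" and fg: "f (?g u) = u" if "u \<in> verts H" for u
    using g f that by (auto simp: bij_betw_apply bij_betw_inv_into_right)
  show ?R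
  proof (intro exI conjI ballI)
    show "inj_on ?g (verts H)" "?g ` verts H \<subseteq> verts G"
      using g W by (auto simp: bij_betw_def)
    show "{u, v} \<in> edges H \<longleftrightarrow> {?g u, ?g v} \<in> edges G"
      if "u \<in> verts H" "v \<in> verts H" for u v
      using adj[OF g_in g_in, OF that] fg that by simp
  qed
next
  assume ?R
  then obtain g where g: "inj_on g (verts H)" "g ` verts H \<subseteq> verts G"
    and adj: "\<forall>u \<in> verts H. \<forall>v \<in> verts H. {u, v} \<in> edges H \<longleftrightarrow> {g u, g v} \<in> edges G"
    by (elim exE conjE)
  let ?W = "g ` verts H" and ?f = "inv_into (verts H) g"
  have "bij_betw ?f ?W (verts H)"
    using g(1) by (intro bij_betw_inv_into) (simp add: bij_betw_def)
  moreover have "{u, v} \<in> edges G \<longleftrightarrow> {?f u, ?f v} \<in> edges H" if "u \<in> ?W" "v \<in> ?W" for u v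
    using that adj g(1) by (auto simp: inv_into_f_f)
  ultimately show "contains_induced G H"
    using g(2) unfolding contains_induced_def graph_iso_def induced_subgraph_def
    by (intro exI[of _ ?W] conjI exI[of _ ?f]) auto
qed

lemma contains_induced_trans:
  assumes "contains_induced G H" "contains_induced H F"
  shows "contains_induced G F"
proof -
  obtain g where g: "inj_on g (verts H)" "g ` verts H \<subseteq> verts G"
    "\<forall>u \<in> verts H. \<forall>v \<in> verts H. {u, v} \<in> edges H \<longleftrightarrow> {g u, g v} \<in> edges G"
    using assms(1) unfolding contains_induced_iff_embedding by (elim exE conjE)
  obtain h where h: "inj_on h (verts F)" "h ` verts F \<subseteq> verts H"
    "\<forall>u \<in> verts F. \<forall>v \<in> verts F. {u, v} \<in> edges F \<longleftrightarrow> {h u, h v} \<in> edges H"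
    using assms(2) unfolding contains_induced_iff_embedding by (elim exE conjE)
  have "inj_on (g \<circ> h) (verts F)"
    using g h by (meson comp_inj_on inj_on_subset)
  moreover have "(g \<circ> h) ` verts F \<subseteq> verts G"
    using g(2) h(2) by (auto simp: image_subset_iff)
  moreover have "{u, v} \<in> edges F \<longleftrightarrow> {(g \<circ> h) u, (g \<circ> h) v} \<in> edges G"
    if "u \<in> verts F" "v \<in> verts F" for u v
    using g(3) h(2,3) that by (auto simp: image_subset_iff)
  ultimately show ?thesis
    unfolding contains_induced_iff_embedding by blast
qed

lemma contains_induced_induced_subgraph:
  "W \<subseteq> verts G \<Longrightarrow> contains_induced G (induced_subgraph G W)"
  unfolding contains_induced_iff_embedding
  by (intro exI[of _ id]) (auto simp: induced_subgraph_def)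

lemma path_graph_contains_shorter:
  "m \<le> n \<Longrightarrow> contains_induced (path_graph n) (path_graph m)"
  unfolding contains_induced_iff_embedding
  by (intro exI[of _ id]) (auto simp: path_graph_def doubleton_eq_iff)

lemma complete_bipartite_contains_smaller:
  "k \<le> n \<Longrightarrow> l \<le> m \<Longrightarrow> contains_induced (complete_bipartite n m) (complete_bipartite k l)"
  unfolding contains_induced_iff_embedding
  by (intro exI[of _ id]) (auto simp: complete_bipartite_def doubleton_eq_iff)

section \<open>Transfer of the defining property of $N_1$ to arbitrary vertex types\<close>

text \<open>\<open>N1_property\<close> speaks only of graphs on \<open>nat\<close>. Numbering the
  finitely many vertices carries \<open>G\<close> to an isomorphic graph \<open>G'\<close> on
  \<open>nat\<close>, and what \<open>G'\<close> contains, \<open>G\<close> contains by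
  transitivity.\<close>

lemma N1_property_any_type:
  fixes G :: "'a graph"
  assumes N: "N1_property n N" and G: "simple_graph G" "connected_graph G"
    and card: "N \<le> int (card (verts G))"
  shows "contains_induced G (path_graph n) \<or> contains_induced G (complete_graph n) \<or>
    contains_induced G (complete_bipartite 1 n)"
proof -
  have fin: "finite (verts G)" and sub: "edges G \<subseteq> [verts G]\<^bsup>2\<^esup>"
    using G(1) by (auto simp: simple_graph_def)
  obtain f where f: "bij_betw f (verts G) {..<card (verts G)}"
    using ex_bij_betw_finite_nat[OF fin] by (auto simp: atLeast0LessThan)
  define G' where "G' = ({..<card (verts G)}, (`) f ` edges G)"
  have inj: "inj_on f (verts G)" and img: "f ` verts G = verts G'"
    using f by (auto simp: bij_betw_def G'_def)
  have "f ` e \<in> [verts G']\<^bsup>2\<^esup>" if "e \<in> edges G" for e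
    using that sub inj img
    by (force simp: nsets_def card_image inj_on_subset)
  then have "simple_graph G'"
    by (auto simp: simple_graph_def G'_def)
  moreover have "connected_graph G'"
    unfolding connected_graph_def
  proof (intro conjI ballI)
    show "verts G' \<noteq> {}"
      using G(2) img by (auto simp: connected_graph_def)
    fix x y assume "x \<in> verts G'" "y \<in> verts G'"
    then obtain a b where "a \<in> verts G" "b \<in> verts G" and ab: "x = f a" "y = f b"
      using img by blast
    then have "(a, b) \<in> {(x, y). {x, y} \<in> edges G}\<^sup>*"
      using G(2) by (auto simp: connected_graph_def)
    then show "(x, y) \<in> {(x, y). {x, y} \<in> edges G'}\<^sup>*"
      unfolding ab
    proof (induction rule: rtrancl_induct)
      case (step u v)
      then have "f ` {u, v} \<in> edges G'"
        unfolding G'_def snd_conv by (intro imageI) simp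
      with step.IH show ?case
        by (auto intro: rtrancl_into_rtrancl)
    qed simp
  qed
  moreover have "N \<le> int (card (verts G'))"
    using card by (simp add: G'_def)
  ultimately have "contains_induced G' (path_graph n) \<or> contains_induced G' (complete_graph n) \<or>
    contains_induced G' (complete_bipartite 1 n)"
    using N unfolding N1_property_def by blast
  moreover have emb: "contains_induced G G'"
  proof -
    have "{u, v} \<in> edges G \<longleftrightarrow> {f u, f v} \<in> edges G'" if uv: "u \<in> verts G" "v \<in> verts G" for u v
    proof -
      \<comment> \<open>Taking images under \<open>f\<close> is injective on subsets of
        \<open>verts G\<close>, so no non-edge is sent to an edge.\<close>
      have "f ` {u, v} \<in> (`) f ` edges G \<longleftrightarrow> {u, v} \<in> edges G"
      proof (rule inj_on_image_mem_iff[OF inj_on_image_Pow[OF inj]])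
        show "edges G \<subseteq> Pow (verts G)"
          using sub by (auto simp: nsets_def)
      qed (use uv in simp)
      then show ?thesis by (simp add: G'_def)
    qed
    then have "graph_iso (induced_subgraph G (verts G)) G'"
      using f by (auto simp: graph_iso_def induced_subgraph_def G'_def)
    then show ?thesis
      by (auto simp: contains_induced_def)
  qed
  ultimately show ?thesis
    by (auto intro: contains_induced_trans[OF emb])
qed

section \<open>Reachability inside a vertex set, and cut vertices\<close>

text \<open>The reachability relation of \<open>induced_subgraph G W\<close>, with \<open>W\<close>
  explicit so that vertices can be deleted while \<open>G\<close> stays fixed. Being a reflexive
  closure over the whole type, it relates points outside \<open>W\<close> to themselves.\<close>

definition reach :: "'a graph \<Rightarrow> 'a set \<Rightarrow> 'a rel" where
  "reach G W = {(x, y). {x, y} \<in> edges G \<and> x \<in> W \<and> y \<in> W}\<^sup>*"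

lemma connected_induced_subgraph_iff:
  "connected_graph (induced_subgraph G W) \<longleftrightarrow>
     W \<noteq> {} \<and> (\<forall>u \<in> W. \<forall>v \<in> W. (u, v) \<in> reach G W)"
  by (simp add: connected_graph_def induced_subgraph_def reach_def)

lemma reach_edge: "{x, y} \<in> edges G \<Longrightarrow> x \<in> W \<Longrightarrow> y \<in> W \<Longrightarrow> (x, y) \<in> reach G W"
  by (auto simp: reach_def)

lemma reach_refl [simp]: "(x, x) \<in> reach G W"
  by (simp add: reach_def)

lemma reach_trans: "(x, y) \<in> reach G W \<Longrightarrow> (y, z) \<in> reach G W \<Longrightarrow> (x, z) \<in> reach G W"
  unfolding reach_def by (rule rtrancl_trans)

lemma reach_sym: "(x, y) \<in> reach G W \<Longrightarrow> (y, x) \<in> reach G W"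
  unfolding reach_def by (rule symD[OF sym_rtrancl]) (auto simp: sym_def insert_commute)

text \<open>Some vertex \<open>x\<close> lies in another component of \<open>W - {v}\<close> than
  \<open>w\<close>. A walk in \<open>W\<close> from \<open>x\<close> to \<open>v\<close> stays in
  the component of \<open>x\<close> until it first meets \<open>v\<close>, so the vertex just before
  that is the required neighbour.\<close>

lemma cut_vertex_neighbour:
  assumes conn: "connected_graph (induced_subgraph G W)"
    and cut: "\<not> connected_graph (induced_subgraph G (W - {v}))"
    and v: "v \<in> W" and w: "w \<in> W" "w \<noteq> v"
  obtains u where "u \<in> W - {v}" "{v, u} \<in> edges G" "(u, w) \<notin> reach G (W - {v})"
proof -
  obtain a b where "a \<in> W - {v}" "b \<in> W - {v}" "(a, b) \<notin> reach G (W - {v})"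
    using cut w by (auto simp: connected_induced_subgraph_iff)
  \<comment> \<open>If both \<open>a\<close> and \<open>b\<close> reached \<open>w\<close>, they
    would reach each other.\<close>
  then obtain x where x: "x \<in> W - {v}" "(x, w) \<notin> reach G (W - {v})"
    using reach_trans reach_sym by metis
  have "(x, v) \<in> reach G W"
    using conn x(1) v by (auto simp: connected_induced_subgraph_iff)
  then have "(x, v) \<in> {(x, y). {x, y} \<in> edges G \<and> x \<in> W \<and> y \<in> W}\<^sup>*"
    by (simp add: reach_def)
  \<comment> \<open>Induction from the front of the walk: if the next vertex is \<open>v\<close>,
    the current one is the witness; otherwise the step stays in \<open>W - {v}\<close>, and the next
    vertex is separated from \<open>w\<close> as well.\<close>
  then have "\<exists>u \<in> W - {v}. {v, u} \<in> edges G \<and> (u, w) \<notin> reach G (W - {v})"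
    using x
  proof (induction rule: converse_rtrancl_induct)
    case base
    then show ?case by simp
  next
    case (step y z)
    show ?case
    proof (cases "z = v")
      case True
      with step show ?thesis by (auto simp: insert_commute)
    next
      case False
      with step have "(y, z) \<in> reach G (W - {v})"
        by (auto intro: reach_edge)
      with step False show ?thesis
        by (auto dest: reach_trans)
    qed
  qed
  with that show thesis by blast
qed

section \<open>Building $H_n^1$ from a clique of cut vertices\<close>

lemma verts_H1_graph: "verts (H1_graph n) = Inl ` {..<n} \<union> Inr ` {..<n}"
  by (simp add: H1_graph_def)

lemma H1_graph_adjacent_iff:
  "{x, y} \<in> edges (H1_graph n) \<longleftrightarrow>
    (case (x, y) of
      (Inl i, Inl j) \<Rightarrow> i < n \<and> j < n \<and> i \<noteq> j
    | (Inl i, Inr j) \<Rightarrow> i < n \<and> i = j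
    | (Inr i, Inl j) \<Rightarrow> i < n \<and> i = j
    | (Inr i, Inr j) \<Rightarrow> False)"
  by (cases x; cases y) (auto simp: H1_graph_def doubleton_eq_iff)

text \<open>Each \<open>v\<close> in \<open>C\<close> gets a pendant \<open>p v\<close> in a
  component of \<open>W - {v}\<close> that misses \<open>K - {v}\<close>. This separation alone
  excludes every unwanted edge, both from pendants to the clique and between pendants.\<close>

lemma H1_graph_if_clique_of_cut_vertices:
  assumes G: "simple_graph G" and W: "W \<subseteq> verts G"
    and conn: "connected_graph (induced_subgraph G W)"
    and K: "K \<subseteq> W" "finite K" "2 \<le> card K"
    and clique: "\<And>x y. x \<in> K \<Longrightarrow> y \<in> K \<Longrightarrow> x \<noteq> y \<Longrightarrow> {x, y} \<in> edges G"
    and C: "C \<subseteq> K" "card C = n"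
    and cut: "\<And>v. v \<in> C \<Longrightarrow> \<not> connected_graph (induced_subgraph G (W - {v}))"
  shows "contains_induced G (H1_graph n)"
proof -
  have loopless: "{x} \<notin> edges G" for x
    using G by (auto simp: simple_graph_def nsets_def)
  have "\<exists>u \<in> W - {v}. {v, u} \<in> edges G \<and> (\<forall>x \<in> K - {v}. (u, x) \<notin> reach G (W - {v}))"
    if v: "v \<in> C" for v
  proof -
    have "\<not> K \<subseteq> {v}"
      using K(3) card_mono[of "{v}" K] by auto
    then obtain w where w: "w \<in> K" "w \<noteq> v" by blast
    obtain u where u: "u \<in> W - {v}" "{v, u} \<in> edges G" "(u, w) \<notin> reach G (W - {v})"
      using cut_vertex_neighbour[OF conn cut[OF v], of w] v C K w by blast
    \<comment> \<open>The clique \<open>K - {v}\<close> survives the deletion of \<open>v\<close>,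
      so it lies in the component of \<open>w\<close>, and avoiding \<open>w\<close> means avoiding
      all of it.\<close>
    moreover have "(u, x) \<notin> reach G (W - {v})" if x: "x \<in> K - {v}" for x
    proof
      assume "(u, x) \<in> reach G (W - {v})"
      moreover have "(x, w) \<in> reach G (W - {v})"
        using x w K(1) clique by (cases "x = w") (auto intro!: reach_edge)
      ultimately show False using u(3) reach_trans by metis
    qed
    ultimately show ?thesis by blast
  qed
  then obtain p where p: "\<And>v. v \<in> C \<Longrightarrow> p v \<in> W - {v}" "\<And>v. v \<in> C \<Longrightarrow> {v, p v} \<in> edges G"
    and sep: "\<And>v x. v \<in> C \<Longrightarrow> x \<in> K \<Longrightarrow> x \<noteq> v \<Longrightarrow> (p v, x) \<notin> reach G (W - {v})"
    by (metis Diff_iff singletonD)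
  \<comment> \<open>Otherwise \<open>p v\<close> would be a vertex of \<open>K - {v}\<close> that is
    separated from itself.\<close>
  have p_notin: "p v \<notin> K" if "v \<in> C" for v
    using p(1)[OF that] sep[OF that, of "p v"] by auto
  have p_clique: "{p v, x} \<notin> edges G" if "v \<in> C" "x \<in> K" "x \<noteq> v" for v x
    using that sep[of v x] p(1)[of v] K(1) by (auto intro: reach_edge)
  have p_apart: "p v \<noteq> p w \<and> {p v, p w} \<notin> edges G" if vw: "v \<in> C" "w \<in> C" "v \<noteq> w" for v w
  proof -
    have pw: "p w \<in> W - {v}"
      using p(1)[of w] p_notin[of w] vw C by auto
    \<comment> \<open>The edge from \<open>w\<close> to its pendant survives the deletion of
      \<open>v\<close>. So \<open>p w\<close> lies in the component of \<open>w\<close>, which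
      \<open>p v\<close> avoids; this rules out both equality and adjacency of the two
      pendants.\<close>
    have "(p w, w) \<in> reach G (W - {v})"
      using p(2)[of w] pw vw C K by (intro reach_edge) (auto simp: insert_commute)
    then have "(p v, p w) \<notin> reach G (W - {v})"
      using sep[of v w] vw C reach_trans[of "p v" "p w" G _ w] by blast
    then show ?thesis
      using pw p(1)[of v] vw by (auto intro: reach_edge)
  qed
  have "finite C" using C(1) K(2) by (rule finite_subset)
  then obtain c where c: "bij_betw c {..<n} C"
    using ex_bij_betw_nat_finite C by (metis atLeast0LessThan)
  have cC: "c i \<in> C" if "i < n" for i
    using c that by (auto simp: bij_betw_def)
  have c_eq: "c i = c j \<longleftrightarrow> i = j" if "i < n" "j < n" for i j
    using c that by (auto simp: bij_betw_def inj_on_def)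
  have cK: "c i \<in> K" if "i < n" for i
    using cC that C by blast
  \<comment> \<open>Clique vertex number \<open>i\<close> goes to \<open>c i\<close>, and its
    pendant vertex to \<open>p (c i)\<close>.\<close>
  let ?g = "case_sum c (p \<circ> c)"
  have "inj_on ?g (verts (H1_graph n))"
  proof -
    have "c i \<noteq> p (c j)" if "i < n" "j < n" for i j
      using that cC cK p_notin by metis
    moreover have "p (c i) = p (c j) \<longleftrightarrow> i = j" if "i < n" "j < n" for i j
      using that cC c_eq p_apart by metis
    ultimately have "?g x = ?g y \<longleftrightarrow> x = y"
      if "x \<in> verts (H1_graph n)" "y \<in> verts (H1_graph n)" for x y
      using that c_eq by (cases x; cases y) (auto simp: H1_graph_def dest: sym)
    then show ?thesis
      by (simp add: inj_on_def)
  qed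
  moreover have "?g ` verts (H1_graph n) \<subseteq> verts G"
  proof -
    have "c i \<in> verts G" "p (c i) \<in> verts G" if "i < n" for i
      using cK[OF that] p(1)[OF cC[OF that]] K(1) W by blast+
    then show ?thesis
      by (auto simp: H1_graph_def)
  qed
  moreover have "{x, y} \<in> edges (H1_graph n) \<longleftrightarrow> {?g x, ?g y} \<in> edges G"
    if xy: "x \<in> verts (H1_graph n)" "y \<in> verts (H1_graph n)" for x y
  proof -
    have LL: "{c i, c j} \<in> edges G \<longleftrightarrow> i \<noteq> j" if "i < n" "j < n" for i j
      using clique[OF cK cK, OF that] c_eq[OF that] loopless[of "c j"] by (cases "i = j") simp_all
    have RL: "{p (c i), c j} \<in> edges G \<longleftrightarrow> i = j" if "i < n" "j < n" for i j
      using p_clique[OF cC cK, OF that] c_eq[OF that] p(2)[OF cC, OF that(1)]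
      by (cases "i = j") (auto simp: insert_commute)
    have LR: "{c j, p (c i)} \<in> edges G \<longleftrightarrow> i = j" if "i < n" "j < n" for i j
      using RL[OF that] by (simp add: insert_commute)
    have RR: "{p (c i), p (c j)} \<notin> edges G" if "i < n" "j < n" for i j
      using p_apart[OF cC cC, OF that] c_eq[OF that] loopless[of "p (c j)"]
      by (cases "i = j") simp_all
    show ?thesis
      using xy LL RL LR RR unfolding H1_graph_adjacent_iff verts_H1_graph by auto
  qed
  ultimately show ?thesis
    unfolding contains_induced_iff_embedding by blast
qed

section \<open>Minimal connected sets around a maximum independent set\<close>

text \<open>\<open>Max\<close> is attained on a finite non-empty set. Finiteness comes from the
  finite vertex set, non-emptiness from the independent set \<open>{}\<close>.\<close>

lemma independence_number_witness:
  assumes "simple_graph G"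
  obtains S where "S \<subseteq> verts G" "indep S (edges G)" "card S = independence_number G"
proof -
  let ?A = "{card S | S. S \<subseteq> verts G \<and> indep S (edges G)}"
  have fin: "finite (verts G)"
    using assms by (simp add: simple_graph_def)
  have "?A = card ` {S. S \<subseteq> verts G \<and> indep S (edges G)}" by blast
  moreover have "finite {S. S \<subseteq> verts G \<and> indep S (edges G)}"
    using fin by (auto intro: finite_subset[of _ "Pow (verts G)"])
  ultimately have "finite ?A" by simp
  moreover have "card {} \<in> ?A"
    by (intro CollectI exI[of _ "{}"]) (simp add: indep_def)
  ultimately have "independence_number G \<in> ?A"
    unfolding independence_number_def by (intro Max_in) blast+
  then show thesis using that by auto
qed

theorem theorem2p2:
  fixes N1 :: "nat \<Rightarrow> int" and n :: nat and G :: "'a graph"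
  assumes N1: "\<And>m. m \<ge> 1 \<Longrightarrow> N1_property m (N1 m)"
    and n: "n \<ge> 1"
    and G: "simple_graph G" "connected_graph G"
    and indep: "int (independence_number G) \<ge> N1 (n + 1)"
  shows "contains_induced G (path_graph n) \<or>
         contains_induced G (H1_graph n) \<or>
         contains_induced G (complete_bipartite 1 n)"
proof -
  have fin: "finite (verts G)" and sub: "edges G \<subseteq> [verts G]\<^bsup>2\<^esup>"
    using G(1) by (auto simp: simple_graph_def)
  obtain S where S: "S \<subseteq> verts G" "indep S (edges G)" "card S = independence_number G"
    using independence_number_witness[OF G(1)] .
  \<comment> \<open>The candidates for \<open>W\<close>. The whole vertex set is one of them, so
    there is one of least cardinality.\<close>
  define P where "P W \<longleftrightarrow> S \<subseteq> W \<and> W \<subseteq> verts G \<and> connected_graph (induced_subgraph G W)" for W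
  have "induced_subgraph G (verts G) = G"
    using sub by (cases G) (auto simp: induced_subgraph_def nsets_def)
  then have "P (verts G)"
    using S G by (simp add: P_def)
  then obtain W where "P W" and least: "\<And>W'. P W' \<Longrightarrow> card W \<le> card W'"
    by (metis ex_has_least_nat)
  then have W: "S \<subseteq> W" "W \<subseteq> verts G" and conn: "connected_graph (induced_subgraph G W)"
    by (auto simp: P_def)
  have finW: "finite W"
    using W fin finite_subset by blast
  \<comment> \<open>Deleting \<open>v\<close> outside \<open>S\<close> keeps \<open>S\<close>
    covered and lowers the cardinality, so by minimality it is connectedness that must fail.\<close>
  have cut: "\<not> connected_graph (induced_subgraph G (W - {v}))" if "v \<in> W - S" for v
    using least[of "W - {v}"] that W card_Diff1_less[OF finW, of v] by (auto simp: P_def)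
  have GW: "contains_induced G (induced_subgraph G W)"
    using W(2) by (rule contains_induced_induced_subgraph)
  have "simple_graph (induced_subgraph G W)"
    using finW sub by (auto simp: simple_graph_def induced_subgraph_def nsets_def)
  moreover have "card S \<le> card W"
    using W(1) finW by (rule card_mono[rotated])
  then have "N1 (n + 1) \<le> int (card (verts (induced_subgraph G W)))"
    using indep S(3) by (simp add: induced_subgraph_def)
  \<comment> \<open>The parameter is \<open>n + 1\<close> because the clique may lose one vertex to
    \<open>S\<close>. The path and the star of the larger size contain those of size
    \<open>n\<close>.\<close>
  ultimately have "contains_induced (induced_subgraph G W) (path_graph (n + 1)) \<or>
      contains_induced (induced_subgraph G W) (complete_graph (n + 1)) \<or>
      contains_induced (induced_subgraph G W) (complete_bipartite 1 (n + 1))"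
    using N1_property_any_type[OF N1 _ conn] by simp
  then consider
      (path) "contains_induced (induced_subgraph G W) (path_graph (n + 1))"
    | (clique) "contains_induced (induced_subgraph G W) (complete_graph (n + 1))"
    | (star) "contains_induced (induced_subgraph G W) (complete_bipartite 1 (n + 1))"
    by blast
  then show ?thesis
  proof cases
    case path
    then show ?thesis
      using GW path_graph_contains_shorter[of n "n + 1"] contains_induced_trans
      by (metis le_add1)
  next
    case star
    then show ?thesis
      using GW complete_bipartite_contains_smaller[of 1 1 n "n + 1"] contains_induced_trans
      by (metis le_add1 order_refl)
  next
    case clique
    then obtain g where g: "inj_on g {..<n + 1}" "g ` {..<n + 1} \<subseteq> W"
      and adj: "\<And>i j. i < n + 1 \<Longrightarrow> j < n + 1 \<Longrightarrow>
        {i, j} \<in> [{..<n + 1}]\<^bsup>2\<^esup> \<longleftrightarrow> {g i, g j} \<in> edges (induced_subgraph G W)"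
      unfolding contains_induced_iff_embedding complete_graph_def
      by (auto simp: induced_subgraph_def)
    define K where "K = g ` {..<n + 1}"
    have K: "K \<subseteq> W" "finite K" "card K = n + 1"
      using g by (auto simp: K_def card_image)
    have edge: "{x, y} \<in> edges G" if xy: "x \<in> K" "y \<in> K" "x \<noteq> y" for x y
    proof -
      obtain i j where ij: "x = g i" "y = g j" "i < n + 1" "j < n + 1" "i \<noteq> j"
        using xy by (auto simp: K_def)
      then have "{i, j} \<in> [{..<n + 1}]\<^bsup>2\<^esup>"
        by (auto simp: nsets_def)
      then show ?thesis
        using adj[of i j] ij by (simp add: induced_subgraph_def)
    qed
    \<comment> \<open>Distinct vertices of \<open>K\<close> are adjacent, while \<open>S\<close> is
      independent.\<close>
    have "x = y" if "x \<in> K \<inter> S" "y \<in> K \<inter> S" for x y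
      using that edge[of x y] S(2) by (auto simp: indep_def)
    then have "card (K \<inter> S) \<le> 1"
      using K(2) by (simp add: card_le_Suc0_iff_eq)
    then have "n \<le> card (K - S)"
      using K card_Diff_subset_Int[of K S] by simp
    then obtain C where C: "C \<subseteq> K - S" "card C = n"
      using obtain_subset_with_card_n by metis
    have "contains_induced G (H1_graph n)"
    proof (rule H1_graph_if_clique_of_cut_vertices[OF G(1) W(2) conn K(1,2) _ edge])
      \<comment> \<open>\<open>K\<close> has \<open>n + 1\<close> vertices, so
        \<open>n \<ge> 1\<close> supplies the second clique vertex from which a pendant is to be
        separated.\<close>
      show "2 \<le> card K" using K(3) n by simp
      show "\<not> connected_graph (induced_subgraph G (W - {v}))" if "v \<in> C" for v
        using that C K(1) by (intro cut) blast
    qed (use C in auto)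
    then show ?thesis by blast
  qed
qed

end
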